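(* Let $\lambda$ be a partition and $h_1,\dots,h_s$ rim-hooks of $\lambda$ with $h_i\le h_{i+1}$ for all $i\in[s-1]$. Then for all $i\in[s]$, $h_i$ inserts into $h_{i+1}*\cdots*h_s*0$, and the minimum of $\mathrm{cand}(h_i*\cdots*h_s*0)$ with respect to the content order is $\alpha(P(h_i,h_{i+1}*\cdots*h_s*0))$.
   Context: Cells are pairs $(i,j)\in\mathbb Z^2$; $\mathrm n(i,j)=(i-1,j)$, $\mathrm e(i,j)=(i,j+1)$, $\mathrm s(i,j)=(i+1,j)$, $\mathrm w(i,j)=(i,j-1)$. A partition $\lambda$ is identified with its Young diagram; $\lambda'$ is its conjugate. A reverse plane partition of shape $\lambda$ is $\pi:\lambda\to\mathbb N$ with $\pi(u)\le\pi(\mathrm e u),\pi(\mathrm s u)$, with conventions $\pi(i,j)=0$ if $i\le0$ or $j\le0$, $\pi(i,j)=\infty$ if $i,j\ge1$, $(i,j)\notin\lambda$; $0$ denotes the zero reverse plane partition of shape $\lambda$. Content $c(i,j)=j-i$; outer corner: $u\in\lambda$, $\mathrm e u,\mathrm s u\notin\lambda$; inner corner: $\mathrm e u,\mathrm s u\in\lambda$, $\mathrm e\mathrm s u\notin\lambda$. With inner corner contents $i_1<\dots<i_r$ and outer corner contents $o_1<\dots<o_{r+1}$ (interlacing), $\mathcal I=\{u\in\lambda:c(u)=i_k\}$, $\mathcal O=\{u\in\lambda:c(u)=o_k\}$, $\mathcal A=\{u\in\lambda:c(u)<o_1\text{ or }i_k<c(u)<o_{k+1}\text{ for some }k\in[r]\}$,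 $\mathcal B=\{u\in\lambda:o_k<c(u)<i_k\text{ for some }k\in[r]\text{ or }c(u)>o_{r+1}\}$. Content order: $(i,j)\trianglelefteq(k,l)$ iff $j-i>l-k$, or $j-i=l-k$ and $i\ge k$. Candidates: $\mathrm{cand}(\pi)=\{u\in\mathcal O:\pi(u)>\pi(\mathrm w u)\}\cup\{u\in\mathcal A:\pi(u)>\pi(\mathrm w u),\pi(u)>\pi(\mathrm n u)\}$. North-east path: $(u_0,\dots,u_s)$ in $\lambda$, $u_k\in\{\mathrm n u_{k-1},\mathrm e u_{k-1}\}$, length $s$, head $\alpha=u_0$, tail $\omega=u_s$. South-west path: $(v_0,\dots,v_s)$, $v_k\in\{\mathrm s v_{k-1},\mathrm w v_{k-1}\}$, length $s$, $\alpha=v_s$, $\omega=v_0$. Rim-hook: north-east path $h$ with $\mathrm s\alpha(h)\notin\lambda$, $\mathrm e\omega(h)\notin\lambda$, $\mathrm e\mathrm s u\notin\lambda$ for all $u\in h$; for $u=(i,j)\in\lambda$, $h^u$ is the rim-hook from $(\lambda'_j,j)$ to $(i,\lambda_i)$, and these are all rim-hooks. Reverse lexicographic order on cells: $(i,j)\le(k,l)$ iff $j>l$, or $j=l$ and $i\ge k$; rim-hooks ordered by $h^u\le h^v$ iff $u\le v$. $(\pi+P)(u)=\pi(u)+1$ for $u\in P$, else $\pi(u)$. $(P,\pi)$ compatible: $u\in P\cap(\mathcal I\cup\mathcal A)$ implies $\mathrm e u\in P$ and $\pi(u)=\pi(\mathrm e u)$; $u,\mathrm s u\in P$ implies $\pi(u)=\pi(\mathrm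 s u)$. $h$ inserts into $\pi$ if some path $P$ has $\omega(P)=\omega(h)$, $\ell(P)=\ell(h)$, $(P,\pi)$ compatible and $\pi+P$ a reverse plane partition; then $h*\pi=\pi+P(h,\pi)$, with $P(h,\pi)$ the south-west path starting at $\omega(h)$ which, while its length is less than $\ell(h)$, moves from current cell $u$ to $\mathrm s u$ if $u\in\mathcal B\cup\mathcal I$ and $\pi(u)=\pi(\mathrm s u)$, and to $\mathrm w u$ otherwise. Iterated insertion is read right to left: $h_i*\cdots*h_s*0=h_i*(\cdots(h_s*0))$. *)

theory Defs
  imports "HOL-Library.Extended_Nat"
begin

section \<open>Cells and Young diagrams\<close>

text \<open>Matrix (English) convention: the first coordinate is the row and grows southwards.\<close>

type_synonym cell = "int \<times> int"

definition north :: "cell \<Rightarrow> cell" where "north u = (fst u - 1, snd u)"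
definition east :: "cell \<Rightarrow> cell" where "east u = (fst u, snd u + 1)"
definition south :: "cell \<Rightarrow> cell" where "south u = (fst u + 1, snd u)"
definition west :: "cell \<Rightarrow> cell" where "west u = (fst u, snd u - 1)"

definition is_partition :: "nat list \<Rightarrow> bool" where
  "is_partition lam \<longleftrightarrow> sorted_wrt (\<ge>) lam \<and> 0 \<notin> set lam"

text \<open>Rows are numbered from 1; rows beyond the number of parts have length 0.\<close>

definition row_len :: "nat list \<Rightarrow> int \<Rightarrow> int" where
  "row_len lam i = (if 1 \<le> i \<and> i \<le> int (length lam) then int (lam ! nat (i - 1)) else 0)"

text \<open>The conjugate partition, for column indices \<open>j \<ge> 1\<close>.\<close>

definition col_len :: "nat list \<Rightarrow> int \<Rightarrow> int" where
  "col_len lam j = int (card {i. 1 \<le> i \<and> i \<le> int (length lam) \<and> j \<le> row_len lam i})"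

definition diagram :: "nat list \<Rightarrow> cell set" where
  "diagram lam = {(i, j). 1 \<le> i \<and> 1 \<le> j \<and> j \<le> row_len lam i}"

definition content :: "cell \<Rightarrow> int" where
  "content u = snd u - fst u"

definition outer_corners :: "nat list \<Rightarrow> cell set" where
  "outer_corners lam =
     {u \<in> diagram lam. east u \<notin> diagram lam \<and> south u \<notin> diagram lam}"

definition inner_corners :: "nat list \<Rightarrow> cell set" where
  "inner_corners lam =
     {u \<in> diagram lam. east u \<in> diagram lam \<and> south u \<in> diagram lam
        \<and> east (south u) \<notin> diagram lam}"

text \<open>The increasing enumerations \<open>i\<^sub>1 < \<dots> < i\<^sub>r\<close> and \<open>o\<^sub>1 < \<dots> < o\<^sub>r\<^sub>+\<^sub>1\<close>
  of corner contents, with indices starting at 1.\<close>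

definition num_inner :: "nat list \<Rightarrow> nat" where
  "num_inner lam = card (inner_corners lam)"

definition inner_content :: "nat list \<Rightarrow> nat \<Rightarrow> int" where
  "inner_content lam k = sorted_list_of_set (content ` inner_corners lam) ! (k - 1)"

definition outer_content :: "nat list \<Rightarrow> nat \<Rightarrow> int" where
  "outer_content lam k = sorted_list_of_set (content ` outer_corners lam) ! (k - 1)"

definition region_I :: "nat list \<Rightarrow> cell set" where
  "region_I lam = {u \<in> diagram lam. \<exists>k\<in>{1..num_inner lam}. content u = inner_content lam k}"

definition region_O :: "nat list \<Rightarrow> cell set" where
  "region_O lam = {u \<in> diagram lam. \<exists>k\<in>{1..num_inner lam + 1}. content u = outer_content lam k}"

definition region_A :: "nat list \<Rightarrow> cell set" where
  "region_A lam = {u \<in> diagram lam. content u < outer_content lam 1 \<or>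
     (\<exists>k\<in>{1..num_inner lam}.
        inner_content lam k < content u \<and> content u < outer_content lam (k + 1))}"

definition region_B :: "nat list \<Rightarrow> cell set" where
  "region_B lam = {u \<in> diagram lam.
     (\<exists>k\<in>{1..num_inner lam}.
        outer_content lam k < content u \<and> content u < inner_content lam k) \<or>
     content u > outer_content lam (num_inner lam + 1)}"

section \<open>Reverse plane partitions\<close>

text \<open>A filling \<open>\<pi> : \<lambda> \<rightarrow> \<nat>\<close> is represented by a function on all cells that vanishes off
  \<open>\<lambda>\<close>. The boundary conventions (0 to the north and west, \<open>\<infinity>\<close> to the south and east) are
  supplied by \<open>entry\<close>, which is used wherever a cell outside \<open>\<lambda>\<close> may be consulted.\<close>

definition entry :: "nat list \<Rightarrow> (cell \<Rightarrow> nat) \<Rightarrow> cell \<Rightarrow> enat" where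
  "entry lam p u =
     (if u \<in> diagram lam then enat (p u) else if fst u \<le> 0 \<or> snd u \<le> 0 then 0 else \<infinity>)"

definition is_rpp :: "nat list \<Rightarrow> (cell \<Rightarrow> nat) \<Rightarrow> bool" where
  "is_rpp lam p \<longleftrightarrow>
     (\<forall>u. u \<notin> diagram lam \<longrightarrow> p u = 0) \<and>
     (\<forall>u\<in>diagram lam. entry lam p u \<le> entry lam p (east u)
        \<and> entry lam p u \<le> entry lam p (south u))"

definition zero_rpp :: "cell \<Rightarrow> nat" where
  "zero_rpp = (\<lambda>u. 0)"

definition content_le :: "cell \<Rightarrow> cell \<Rightarrow> bool" where
  "content_le u v \<longleftrightarrow> content u > content v \<or> (content u = content v \<and> fst u \<ge> fst v)"

definition is_content_min :: "cell set \<Rightarrow> cell \<Rightarrow> bool" where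
  "is_content_min C u \<longleftrightarrow> u \<in> C \<and> (\<forall>v\<in>C. content_le u v)"

definition cand :: "nat list \<Rightarrow> (cell \<Rightarrow> nat) \<Rightarrow> cell set" where
  "cand lam p =
     {u \<in> region_O lam. entry lam p u > entry lam p (west u)} \<union>
     {u \<in> region_A lam. entry lam p u > entry lam p (west u)
        \<and> entry lam p u > entry lam p (north u)}"

section \<open>Paths and rim-hooks\<close>

text \<open>A path is the list of its cells in the order of traversal. Its length is the number of
  steps. The head \<open>\<alpha>\<close> is always the south-west end and the tail \<open>\<omega>\<close> the north-east end, so
  for a south-west path the head is the last and the tail the first cell of the list.\<close>

definition ne_path :: "nat list \<Rightarrow> cell list \<Rightarrow> bool" where
  "ne_path lam h \<longleftrightarrow> h \<noteq> [] \<and> set h \<subseteq> diagram lam \<and>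
     (\<forall>k. Suc k < length h \<longrightarrow> h ! Suc k = north (h ! k) \<or> h ! Suc k = east (h ! k))"

definition sw_path :: "nat list \<Rightarrow> cell list \<Rightarrow> bool" where
  "sw_path lam P \<longleftrightarrow> P \<noteq> [] \<and> set P \<subseteq> diagram lam \<and>
     (\<forall>k. Suc k < length P \<longrightarrow> P ! Suc k = south (P ! k) \<or> P ! Suc k = west (P ! k))"

definition path_len :: "cell list \<Rightarrow> nat" where
  "path_len P = length P - 1"

definition ne_head :: "cell list \<Rightarrow> cell" where "ne_head h = hd h"
definition ne_tail :: "cell list \<Rightarrow> cell" where "ne_tail h = last h"
definition sw_head :: "cell list \<Rightarrow> cell" where "sw_head P = last P"
definition sw_tail :: "cell list \<Rightarrow> cell" where "sw_tail P = hd P"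

definition rim_hook :: "nat list \<Rightarrow> cell list \<Rightarrow> bool" where
  "rim_hook lam h \<longleftrightarrow> ne_path lam h \<and>
     south (ne_head h) \<notin> diagram lam \<and> east (ne_tail h) \<notin> diagram lam \<and>
     (\<forall>u\<in>set h. east (south u) \<notin> diagram lam)"

text \<open>\<open>rim_hook_of lam u h\<close> says that \<open>h\<close> is the rim-hook \<open>h\<^sup>u\<close>.\<close>

definition rim_hook_of :: "nat list \<Rightarrow> cell \<Rightarrow> cell list \<Rightarrow> bool" where
  "rim_hook_of lam u h \<longleftrightarrow> u \<in> diagram lam \<and> rim_hook lam h \<and>
     ne_head h = (col_len lam (snd u), snd u) \<and> ne_tail h = (fst u, row_len lam (fst u))"

definition revlex_le :: "cell \<Rightarrow> cell \<Rightarrow> bool" where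
  "revlex_le u v \<longleftrightarrow> snd u > snd v \<or> (snd u = snd v \<and> fst u \<ge> fst v)"

definition rim_hook_le :: "nat list \<Rightarrow> cell list \<Rightarrow> cell list \<Rightarrow> bool" where
  "rim_hook_le lam h h' \<longleftrightarrow>
     (\<exists>u v. rim_hook_of lam u h \<and> rim_hook_of lam v h' \<and> revlex_le u v)"

section \<open>Insertion\<close>

definition add_path :: "(cell \<Rightarrow> nat) \<Rightarrow> cell list \<Rightarrow> cell \<Rightarrow> nat" where
  "add_path p P = (\<lambda>u. if u \<in> set P then p u + 1 else p u)"

definition compatible :: "nat list \<Rightarrow> cell list \<Rightarrow> (cell \<Rightarrow> nat) \<Rightarrow> bool" where
  "compatible lam P p \<longleftrightarrow>
     (\<forall>u \<in> set P \<inter> (region_I lam \<union> region_A lam).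
        east u \<in> set P \<and> entry lam p u = entry lam p (east u)) \<and>
     (\<forall>u. u \<in> set P \<and> south u \<in> set P \<longrightarrow> entry lam p u = entry lam p (south u))"

text \<open>Reversing a south-west path gives a north-east path with the same cells, head, tail and
  length, so it does not matter which kind of path is quantified over.\<close>

definition inserts :: "nat list \<Rightarrow> cell list \<Rightarrow> (cell \<Rightarrow> nat) \<Rightarrow> bool" where
  "inserts lam h p \<longleftrightarrow> rim_hook lam h \<and> is_rpp lam p \<and>
     (\<exists>P. sw_path lam P \<and> sw_tail P = ne_tail h \<and> path_len P = path_len h \<and>
          compatible lam P p \<and> is_rpp lam (add_path p P))"

definition ins_step :: "nat list \<Rightarrow> (cell \<Rightarrow> nat) \<Rightarrow> cell \<Rightarrow> cell" where
  "ins_step lam p u =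
     (if u \<in> region_B lam \<union> region_I lam \<and> entry lam p u = entry lam p (south u)
      then south u else west u)"

fun ins_walk :: "nat list \<Rightarrow> (cell \<Rightarrow> nat) \<Rightarrow> nat \<Rightarrow> cell \<Rightarrow> cell list" where
  "ins_walk lam p 0 u = [u]"
| "ins_walk lam p (Suc n) u = u # ins_walk lam p n (ins_step lam p u)"

definition ins_path :: "nat list \<Rightarrow> cell list \<Rightarrow> (cell \<Rightarrow> nat) \<Rightarrow> cell list" where
  "ins_path lam h p = ins_walk lam p (path_len h) (ne_tail h)"

text \<open>The product \<open>h * \<pi>\<close>; only meaningful if \<open>inserts lam h p\<close>.\<close>

definition ins :: "nat list \<Rightarrow> cell list \<Rightarrow> (cell \<Rightarrow> nat) \<Rightarrow> cell \<Rightarrow> nat" where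
  "ins lam h p = add_path p (ins_path lam h p)"

text \<open>\<open>ins_list lam [h\<^sub>1, \<dots>, h\<^sub>s] = h\<^sub>1 * (\<dots> * (h\<^sub>s * 0))\<close>\<close>

definition ins_list :: "nat list \<Rightarrow> cell list list \<Rightarrow> cell \<Rightarrow> nat" where
  "ins_list lam hs = foldr (ins lam) hs zero_rpp"

end

theory Submission
  imports Defs
begin

text \<open>Read along the south-east boundary of \<open>\<lambda>\<close>, the four regions are the four patterns of two
  consecutive boundary steps: with \<open>E c\<close> saying that the step from content \<open>c\<close> to \<open>c + 1\<close> is
  horizontal, a cell of content \<open>c\<close> lies in \<open>\<I>\<close>, \<open>\<A>\<close>, \<open>\<O>\<close> or \<open>\<B>\<close> according to the values
  of \<open>E (c - 1)\<close> and \<open>E c\<close>. An insertion path can turn south at \<open>c\<close> only if \<open>E (c - 1)\<close> fails.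

  The invariant of successive insertions is that \<open>\<pi> u = \<pi> (w u)\<close> for every cell \<open>u\<close> with
  \<open>E (c u - 1)\<close> that comes before the last head in the content order. It forces
  \<open>\<pi> u < \<pi> (e (s u))\<close> along the next insertion path, and this strictness makes adding the path
  preserve reverse plane partitions. If the head content strictly increases, the path cannot
  leave the diagram through the first column, because the entry of that column on the head
  diagonal is 0. If the head content stays the same, then the new path starts
  south-east of the old one and remains weakly below it, so its head comes no later in the
  content order.\<close>

section \<open>Ranks in sorted enumerations\<close>

lemma nth_sorted_less_iff:
  fixes xs :: "int list"
  assumes "sorted xs" "k < length xs"
  shows "xs ! k < c \<longleftrightarrow> k < length (filter (\<lambda>x. x < c) xs)"
  using assms
proof (induction xs arbitrary: k)
  case (Cons x xs)
  show ?case
  proof (cases "x < c")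
    case True
    then show ?thesis using Cons by (cases k) auto
  next
    case False
    then have "filter (\<lambda>y. y < c) (x # xs) = []"
      using Cons.prems by (auto simp: filter_empty_conv)
    moreover have "x \<le> (x # xs) ! k"
      using Cons.prems by (cases k) auto
    ultimately show ?thesis using False by simp
  qed
qed simp

text \<open>Comparing the k-th smallest element of a finite set with \<open>c\<close> amounts to
  comparing k with this count. The regions, defined through enumerated corner contents, thus become
  statements about numbers of corners.\<close>

definition count_below :: "int set \<Rightarrow> int \<Rightarrow> nat" where
  "count_below X c = card {x \<in> X. x < c}"

lemma nth_sorted_list_of_set_less_iff:
  assumes "finite X" "k < card X"
  shows "sorted_list_of_set X ! k < c \<longleftrightarrow> k < count_below X c"
proof -
  have "length (filter (\<lambda>x. x < c) (sorted_list_of_set X)) = count_below X c"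
    using assms by (simp add: count_below_def distinct_length_filter Int_def conj_commute)
  then show ?thesis
    using nth_sorted_less_iff[of "sorted_list_of_set X" k c] assms by simp
qed

lemma count_below_Suc:
  assumes "finite X"
  shows "count_below X (c + 1) = count_below X c + (if c \<in> X then 1 else 0)"
proof -
  have "{x \<in> X. x < c + 1} = (if c \<in> X then insert c {x \<in> X. x < c} else {x \<in> X. x < c})"
    by (auto simp: order_less_le)
  then show ?thesis using assms by (simp add: count_below_def)
qed

lemma count_below_le_card: "finite X \<Longrightarrow> count_below X c \<le> card X"
  by (simp add: count_below_def card_mono)

lemma ex_nth_sorted_iff:
  assumes "finite (X :: int set)"
  shows "(\<exists>k\<in>{1..card X}. c = sorted_list_of_set X ! (k - 1)) \<longleftrightarrow> c \<in> X"
proof -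
  have "c \<in> X \<longleftrightarrow> (\<exists>k<card X. c = sorted_list_of_set X ! k)"
    using assms by (metis in_set_conv_nth set_sorted_list_of_set length_sorted_list_of_set)
  then show ?thesis unfolding image_Suc_lessThan[symmetric] by auto
qed

section \<open>The boundary word and the four regions\<close>

text \<open>Horizontal steps on the far left and vertical ones on the far right make the extreme
  corners ordinary changes of direction. They are also the reason for one more outer than inner
  corner.\<close>

locale boundary_word =
  fixes E :: "int \<Rightarrow> bool" and a b :: int
  assumes left: "c < a \<Longrightarrow> E c" and right: "b \<le> c \<Longrightarrow> \<not> E c"
begin

definition Out :: "int set" where "Out = {c. E (c - 1) \<and> \<not> E c}"
definition Inn :: "int set" where "Inn = {c. \<not> E (c - 1) \<and> E c}"

lemma Out_bounds: "c \<in> Out \<Longrightarrow> a \<le> c \<and> c \<le> b"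
  using left[of c] right[of "c - 1"] by (fastforce simp: Out_def)

lemma Inn_bounds: "c \<in> Inn \<Longrightarrow> a \<le> c \<and> c \<le> b"
  using left[of "c - 1"] right[of c] by (fastforce simp: Inn_def)

lemma finite_Out: "finite Out"
  by (rule finite_subset[of _ "{a..b}"]) (use Out_bounds in auto)

lemma finite_Inn: "finite Inn"
  by (rule finite_subset[of _ "{a..b}"]) (use Inn_bounds in auto)

text \<open>The changes of direction alternate, beginning with an element of \<open>Out\<close>, so
  the surplus of \<open>Out\<close> over \<open>Inn\<close> records just the state before
  \<open>c\<close>.\<close>

lemma count_Out:
  "count_below Out c = count_below Inn c + (if E (c - 1) then 0 else 1)"
proof (cases "a \<le> c")
  case True
  then show ?thesis
  proof (induction c rule: int_ge_induct)
    case base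
    have "{x \<in> Out. x < a} = {}" "{x \<in> Inn. x < a} = {}"
      using Out_bounds Inn_bounds by fastforce+
    then show ?case using left[of "a - 1"] unfolding count_below_def by (simp only:) simp
  next
    case (step c)
    then show ?case
      by (auto simp: count_below_Suc finite_Out finite_Inn) (auto simp: Out_def Inn_def)
  qed
next
  case False
  then have "{x \<in> Out. x < c} = {}" "{x \<in> Inn. x < c} = {}"
    using Out_bounds Inn_bounds by fastforce+
  then show ?thesis using left[of "c - 1"] False unfolding count_below_def by (simp only:) simp
qed

lemma card_Out: "card Out = card Inn + 1"
proof -
  have "{x \<in> Out. x < b + 1} = Out" "{x \<in> Inn. x < b + 1} = Inn"
    using Out_bounds Inn_bounds by fastforce+
  then show ?thesis using count_Out[of "b + 1"] right[of b] unfolding count_below_def by simp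
qed

abbreviation out :: "nat \<Rightarrow> int" where "out k \<equiv> sorted_list_of_set Out ! (k - 1)"
abbreviation inn :: "nat \<Rightarrow> int" where "inn k \<equiv> sorted_list_of_set Inn ! (k - 1)"

lemma out_less_iff:
  "1 \<le> k \<Longrightarrow> k \<le> card Inn + 1 \<Longrightarrow> out k < c \<longleftrightarrow> k \<le> count_below Out c"
  using nth_sorted_list_of_set_less_iff[OF finite_Out, of "k - 1" c] card_Out by auto

lemma inn_less_iff:
  "1 \<le> k \<Longrightarrow> k \<le> card Inn \<Longrightarrow> inn k < c \<longleftrightarrow> k \<le> count_below Inn c"
  using nth_sorted_list_of_set_less_iff[OF finite_Inn, of "k - 1" c] by auto

lemma out_greater_iff:
  "1 \<le> k \<Longrightarrow> k \<le> card Inn + 1 \<Longrightarrow> c < out k \<longleftrightarrow> count_below Out (c + 1) < k"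
  using out_less_iff[of k "c + 1"] by auto

lemma inn_greater_iff:
  "1 \<le> k \<Longrightarrow> k \<le> card Inn \<Longrightarrow> c < inn k \<longleftrightarrow> count_below Inn (c + 1) < k"
  using inn_less_iff[of k "c + 1"] by auto

text \<open>In terms of ranks, the left side says that at most as many elements of
  \<open>Out\<close> are \<open>\<le> c\<close> as elements of \<open>Inn\<close> are
  \<open>< c\<close>. By \<open>count_Out\<close> this leaves no room for a vertical step before
  \<open>c\<close> or for \<open>c\<close> in \<open>Out\<close>.\<close>

lemma horizontal_iff:
  "c < out 1 \<or> (\<exists>k\<in>{1..card Inn}. inn k < c \<and> c < out (k + 1))
     \<longleftrightarrow> E (c - 1) \<and> E c" (is "?L \<longleftrightarrow> ?R")
proof -
  have "?L \<longleftrightarrow> count_below Out (c + 1) < 1 \<or>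
     (\<exists>k\<in>{1..card Inn}. k \<le> count_below Inn c \<and> count_below Out (c + 1) < k + 1)"
    using out_greater_iff[of 1 c] out_greater_iff[of "k + 1" c for k] inn_less_iff[of _ c]
    by (intro disj_cong bex_cong conj_cong) auto
  also have "\<dots> \<longleftrightarrow> count_below Out (c + 1) \<le> count_below Inn c"
  proof
    \<comment> \<open>The index is the number of elements of \<open>Out\<close> up to
      \<open>c\<close>; if it is 0, the first disjunct holds.\<close>
    assume "count_below Out (c + 1) \<le> count_below Inn c"
    then show "count_below Out (c + 1) < 1 \<or>
     (\<exists>k\<in>{1..card Inn}. k \<le> count_below Inn c \<and> count_below Out (c + 1) < k + 1)"
      using count_below_le_card[OF finite_Inn, of c]
      by (cases "count_below Out (c + 1) = 0") (auto intro!: bexI[of _ "count_below Out (c + 1)"])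
  qed auto
  also have "\<dots> \<longleftrightarrow> ?R"
    unfolding count_below_Suc[OF finite_Out] using count_Out[of c] by (auto simp: Out_def[THEN eqset_imp_iff])
  finally show ?thesis .
qed

text \<open>In terms of ranks, the surplus of \<open>Out\<close> over \<open>Inn\<close> before
  \<open>c\<close> must be present and must not be cancelled by an element of \<open>Inn\<close> at
  \<open>c\<close>.\<close>

lemma vertical_iff:
  "(\<exists>k\<in>{1..card Inn}. out k < c \<and> c < inn k) \<or> c > out (card Inn + 1)
     \<longleftrightarrow> \<not> E (c - 1) \<and> \<not> E c" (is "?L \<longleftrightarrow> ?R")
proof -
  have "?L \<longleftrightarrow> (\<exists>k\<in>{1..card Inn}. k \<le> count_below Out c \<and> count_below Inn (c + 1) < k) \<or>
     card Inn + 1 \<le> count_below Out c"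
    using out_less_iff[of "card Inn + 1" c] out_less_iff[of _ c] inn_greater_iff[of _ c]
    by (intro disj_cong bex_cong conj_cong) simp_all
  also have "\<dots> \<longleftrightarrow> count_below Inn (c + 1) < count_below Out c" (is "?M \<longleftrightarrow> ?N")
  proof
    assume ?M
    then show ?N using count_below_le_card[OF finite_Inn, of "c + 1"] by auto
  next
    assume ?N
    then show ?M by (cases "card Inn + 1 \<le> count_below Out c")
      (auto intro!: bexI[of _ "count_below Out c"])
  qed
  also have "\<dots> \<longleftrightarrow> ?R"
    unfolding count_below_Suc[OF finite_Inn] using count_Out[of c] by (auto simp: Inn_def[THEN eqset_imp_iff])
  finally show ?thesis .
qed

end

section \<open>Young diagrams and their rims\<close>

locale young =
  fixes lam :: "nat list"
  assumes partition: "is_partition lam"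
begin

abbreviation D :: "cell set" where "D \<equiv> diagram lam"

lemma row_len_antimono: "1 \<le> i' \<Longrightarrow> i' \<le> i \<Longrightarrow> row_len lam i \<le> row_len lam i'"
proof -
  assume *: "1 \<le> i'" "i' \<le> i"
  have "lam ! nat (i - 1) \<le> lam ! nat (i' - 1)" if "i \<le> int (length lam)" "i' < i"
    using partition sorted_wrt_nth_less[of "(\<ge>)" lam "nat (i' - 1)" "nat (i - 1)"] * that
    by (auto simp: is_partition_def)
  then show ?thesis using * by (cases "i' = i") (auto simp: row_len_def)
qed

lemma diagram_closed:
  "(i, j) \<in> D \<Longrightarrow> 1 \<le> i' \<Longrightarrow> i' \<le> i \<Longrightarrow> 1 \<le> j' \<Longrightarrow> j' \<le> j \<Longrightarrow> (i', j') \<in> D"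
  using row_len_antimono[of i' i] by (auto simp: diagram_def)

lemma diagram_pos: "u \<in> D \<Longrightarrow> 1 \<le> fst u \<and> 1 \<le> snd u"
  by (auto simp: diagram_def)

lemma finite_diagram: "finite D"
proof (rule finite_subset)
  show "D \<subseteq> (SIGMA i:{1..int (length lam)}. {1..row_len lam i})"
    by (auto simp: diagram_def row_len_def split: if_splits)
qed auto

text \<open>The lowest cell of the diagonal qualifies, since its south-east neighbour would be a
  lower one.\<close>

lemma rim_cell_exists:
  assumes "u \<in> D"
  shows "\<exists>r\<in>D. content r = content u \<and> east (south r) \<notin> D"
proof -
  let ?X = "{v \<in> D. content v = content u}"
  have fin: "finite (fst ` ?X)" "fst ` ?X \<noteq> {}" using finite_diagram assms by (simp, blast)
  obtain r where r: "Max (fst ` ?X) = fst r" "r \<in> ?X"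
    by (rule imageE[OF Max_in[OF fin]])
  have "east (south r) \<notin> ?X"
  proof
    assume "east (south r) \<in> ?X"
    then have "fst (east (south r)) \<le> fst r" unfolding r(1)[symmetric] using fin by simp
    then show False by (simp add: east_def south_def)
  qed
  then show ?thesis using r by (auto simp: content_def east_def south_def)
qed

lemma rim_cell_greatest:
  assumes "r \<in> D" "v \<in> D" "east (south r) \<notin> D" "content v = content r"
  shows "fst v \<le> fst r"
proof (rule ccontr)
  assume "\<not> fst v \<le> fst r"
  then have "east (south r) \<in> D"
    using assms diagram_closed[of "fst v" "snd v" "fst r + 1" "snd r + 1"] diagram_pos[of r]
    by (auto simp: content_def east_def south_def)
  then show False using assms by simp
qed

lemma rim_cell_unique:
  assumes "r \<in> D" "v \<in> D" "east (south r) \<notin> D" "east (south v) \<notin> D" "content v = content r"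
  shows "v = r"
  using rim_cell_greatest[of r v] rim_cell_greatest[of v r] assms
  by (auto simp: content_def prod_eq_iff)

text \<open>This is the boundary word \<open>E\<close>; by convention all steps before the first content are
  horizontal.\<close>

definition horiz :: "int \<Rightarrow> bool" where
  "horiz c \<longleftrightarrow> (\<forall>v\<in>D. c < content v) \<or>
     (\<exists>r\<in>D. content r = c \<and> east (south r) \<notin> D \<and> east r \<in> D)"

lemma horiz_rim_iff:
  assumes "r \<in> D" "east (south r) \<notin> D"
  shows "horiz (content r) \<longleftrightarrow> east r \<in> D"
  using assms rim_cell_unique[of r] unfolding horiz_def by blast

lemma no_east_imp_not_horiz:
  assumes "u \<in> D" "east u \<notin> D"
  shows "east (south u) \<notin> D" "\<not> horiz (content u)"
proof -
  show "east (south u) \<notin> D"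
    using assms diagram_closed[of "fst u + 1" "snd u + 1" "fst u" "snd u + 1"] diagram_pos[of u]
    by (auto simp: east_def south_def)
  then show "\<not> horiz (content u)" using horiz_rim_iff assms by blast
qed

text \<open>If \<open>west u\<close> is a cell, it is a rim cell with east neighbour
  \<open>u\<close>. Otherwise \<open>u\<close> ends the first column, no content is smaller than its
  own, and the convention on initial steps applies.\<close>

lemma no_south_imp_horiz:
  assumes "u \<in> D" "south u \<notin> D"
  shows "horiz (content u - 1)"
proof (cases "west u \<in> D")
  case True
  then show ?thesis using assms horiz_rim_iff[of "west u"]
    by (auto simp: west_def east_def south_def content_def diff_diff_eq add.commute)
next
  case False
  have snd: "snd u = 1"
    using False diagram_closed[of "fst u" "snd u" "fst u" "snd u - 1"] diagram_pos[OF assms(1)] assms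
    by (force simp: west_def)
  have "content u - 1 < content v" if "v \<in> D" for v
  proof -
    have "fst v \<le> fst u"
    proof (rule ccontr)
      assume "\<not> ?thesis"
      then have "south u \<in> D"
        using that snd diagram_closed[of "fst v" "snd v" "fst u + 1" 1] diagram_pos[of v]
          diagram_pos[of u] assms by (auto simp: south_def)
      then show False using assms by simp
    qed
    then show ?thesis using snd diagram_pos[OF that] by (simp add: content_def)
  qed
  then show ?thesis by (simp add: horiz_def)
qed

lemma horiz_imp_southeast:
  assumes "u \<in> D" "south u \<in> D" "horiz (content u - 1)"
  shows "east (south u) \<in> D"
proof (rule ccontr)
  assume "\<not> ?thesis"
  then have "\<not> horiz (content (south u))" using no_east_imp_not_horiz assms by blast
  then show False using assms by (simp add: content_def south_def algebra_simps)
qed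

lemma outer_contents: "{c. horiz (c - 1) \<and> \<not> horiz c} = content ` outer_corners lam"
proof (intro equalityI subsetI)
  fix c assume "c \<in> content ` outer_corners lam"
  then show "c \<in> {c. horiz (c - 1) \<and> \<not> horiz c}"
    using no_south_imp_horiz no_east_imp_not_horiz by (auto simp: outer_corners_def)
next
  fix c assume c: "c \<in> {c. horiz (c - 1) \<and> \<not> horiz c}"
  then obtain v where v: "v \<in> D" "content v \<le> c" by (force simp: horiz_def)
  \<comment> \<open>The rim cell wanted lies on the first diagonal or is the east neighbour of the
    rim cell on diagonal \<open>c - 1\<close>.\<close>
  have "\<exists>r\<in>D. content r = c \<and> east (south r) \<notin> D \<and> south r \<notin> D"
  proof (cases "\<forall>v\<in>D. c - 1 < content v")
    case True
    then have "content v = c" using v by force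
    then obtain r where r: "r \<in> D" "content r = c" "east (south r) \<notin> D"
      using rim_cell_exists v by blast
    moreover have "south r \<notin> D"
      using True r by (force simp: content_def south_def)
    ultimately show ?thesis by blast
  next
    case False
    then obtain r where r: "r \<in> D" "content r = c - 1" "east (south r) \<notin> D" "east r \<in> D"
      using c by (auto simp: horiz_def)
    have "east (south (east r)) \<notin> D"
      using r diagram_closed[of "fst r + 1" "snd r + 2" "fst r + 1" "snd r + 1"] diagram_pos[of r]
      by (auto simp: east_def south_def add.commute)
    then show ?thesis using r by (intro bexI[of _ "east r"])
      (auto simp: east_def south_def content_def)
  qed
  then obtain r where r: "r \<in> D" "content r = c" "east (south r) \<notin> D" "south r \<notin> D" by blast
  then have "east r \<notin> D" using c horiz_rim_iff by blast
  then show "c \<in> content ` outer_corners lam" using r by (auto simp: outer_corners_def)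
qed

lemma inner_contents: "{c. \<not> horiz (c - 1) \<and> horiz c} = content ` inner_corners lam"
proof (intro equalityI subsetI)
  fix c assume c: "c \<in> {c. \<not> horiz (c - 1) \<and> horiz c}"
  then obtain r where r: "r \<in> D" "content r = c" "east (south r) \<notin> D" "east r \<in> D"
    by (fastforce simp: horiz_def)
  then have "south r \<in> D" using no_south_imp_horiz[of r] c by blast
  then show "c \<in> content ` inner_corners lam" using r by (auto simp: inner_corners_def)
next
  fix c assume "c \<in> content ` inner_corners lam"
  then obtain r where r: "r \<in> D" "content r = c" "east (south r) \<notin> D" "east r \<in> D" "south r \<in> D"
    by (auto simp: inner_corners_def)
  have "\<not> horiz (c - 1)"
    using horiz_imp_southeast r by blast
  moreover have "horiz c" using r horiz_rim_iff by blast
  ultimately show "c \<in> {c. \<not> horiz (c - 1) \<and> horiz c}" by simp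
qed

text \<open>Inner corners of equal content coincide because they are rim cells. This reconciles
  \<open>num_inner\<close>, which counts cells, with the enumeration of contents.\<close>

lemma card_inner_contents: "card (content ` inner_corners lam) = num_inner lam"
  unfolding num_inner_def
  by (rule card_image, rule inj_onI) (unfold inner_corners_def, blast intro: rim_cell_unique)

lemma regions:
  assumes "u \<in> D"
  shows "u \<in> region_I lam \<longleftrightarrow> \<not> horiz (content u - 1) \<and> horiz (content u)"
    and "u \<in> region_O lam \<longleftrightarrow> horiz (content u - 1) \<and> \<not> horiz (content u)"
    and "u \<in> region_A lam \<longleftrightarrow> horiz (content u - 1) \<and> horiz (content u)"
    and "u \<in> region_B lam \<longleftrightarrow> \<not> horiz (content u - 1) \<and> \<not> horiz (content u)"
proof -
  let ?a = "Min (content ` D)" and ?b = "Max (content ` D) + 1"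
  have fin: "finite (content ` D)" using finite_diagram by simp
  have bounds: "?a \<le> content v \<and> content v < ?b" if "v \<in> D" for v
    using Min_le[OF fin imageI[OF that]] Max_ge[OF fin imageI[OF that]] by linarith
  interpret boundary_word horiz ?a ?b
  proof
    fix c
    have "c < content v" if "c < ?a" "v \<in> D" for v
      using bounds[OF that(2)] that(1) by linarith
    then show "horiz c" if "c < ?a"
      using that unfolding horiz_def by blast
    show "\<not> horiz c" if "?b \<le> c"
    proof
      \<comment> \<open>The cell \<open>u\<close> makes the diagram nonempty; in an empty one the
        first clause of \<open>horiz\<close> would hold vacuously for every content.\<close>
      assume "horiz c"
      then obtain v where v: "v \<in> D" "c \<le> content v"
        using assms unfolding horiz_def by fastforce
      show False using bounds[OF v(1)] v(2) that by linarith
    qed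
  qed
  have [simp]: "content ` inner_corners lam = Inn" "content ` outer_corners lam = Out"
    using inner_contents outer_contents by (auto simp: Inn_def Out_def)
  have [simp]: "num_inner lam = card Inn" using card_inner_contents by simp
  note defs = inner_content_def outer_content_def
  show "u \<in> region_I lam \<longleftrightarrow> \<not> horiz (content u - 1) \<and> horiz (content u)"
    using ex_nth_sorted_iff[OF finite_Inn] assms by (auto simp: region_I_def defs Inn_def)
  show "u \<in> region_O lam \<longleftrightarrow> horiz (content u - 1) \<and> \<not> horiz (content u)"
    using ex_nth_sorted_iff[OF finite_Out] assms card_Out by (auto simp: region_O_def defs Out_def)
  show "u \<in> region_A lam \<longleftrightarrow> horiz (content u - 1) \<and> horiz (content u)"
    using horizontal_iff[of "content u"] assms by (simp add: region_A_def defs)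
  show "u \<in> region_B lam \<longleftrightarrow> \<not> horiz (content u - 1) \<and> \<not> horiz (content u)"
    using vertical_iff[of "content u"] assms by (simp add: region_B_def defs)
qed


section \<open>Reverse plane partitions and insertion walks\<close>

lemma entry_diagram: "u \<in> D \<Longrightarrow> entry lam p u = enat (p u)"
  by (simp add: entry_def)

lemma entry_east: "u \<in> D \<Longrightarrow> entry lam p (east u) = (if east u \<in> D then enat (p (east u)) else \<infinity>)"
  using diagram_pos[of u] by (auto simp: entry_def east_def)

lemma entry_south:
  "u \<in> D \<Longrightarrow> entry lam p (south u) = (if south u \<in> D then enat (p (south u)) else \<infinity>)"
  using diagram_pos[of u] by (auto simp: entry_def south_def)

lemma west_diagram: "u \<in> D \<Longrightarrow> snd u \<noteq> 1 \<Longrightarrow> west u \<in> D"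
  using diagram_closed[of "fst u" "snd u" "fst u" "snd u - 1"] diagram_pos[of u]
  by (auto simp: west_def)

lemma north_diagram: "u \<in> D \<Longrightarrow> fst u \<noteq> 1 \<Longrightarrow> north u \<in> D"
  using diagram_closed[of "fst u" "snd u" "fst u - 1" "snd u"] diagram_pos[of u]
  by (auto simp: north_def)

lemma entry_west:
  assumes "u \<in> D" "\<And>v. v \<notin> D \<Longrightarrow> p v = 0"
  shows "entry lam p (west u) = enat (p (west u))"
proof (cases "west u \<in> D")
  case False
  then have "snd u = 1" using west_diagram assms(1) by blast
  then show ?thesis using False assms(2) by (simp add: entry_def west_def zero_enat_def)
qed (simp add: entry_diagram)

lemma entry_north:
  assumes "u \<in> D" "\<And>v. v \<notin> D \<Longrightarrow> p v = 0"
  shows "entry lam p (north u) = enat (p (north u))"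
proof (cases "north u \<in> D")
  case False
  then have "fst u = 1" using north_diagram assms(1) by blast
  then show ?thesis using False assms(2) by (simp add: entry_def north_def zero_enat_def)
qed (simp add: entry_diagram)

lemma is_rpp_iff:
  "is_rpp lam p \<longleftrightarrow> (\<forall>u. u \<notin> D \<longrightarrow> p u = 0) \<and>
     (\<forall>u\<in>D. (east u \<in> D \<longrightarrow> p u \<le> p (east u)) \<and> (south u \<in> D \<longrightarrow> p u \<le> p (south u)))"
  unfolding is_rpp_def by (auto simp: entry_diagram entry_east entry_south)

lemma rpp_off: "is_rpp lam p \<Longrightarrow> u \<notin> D \<Longrightarrow> p u = 0"
  unfolding is_rpp_def by blast

lemma rpp_east: "is_rpp lam p \<Longrightarrow> u \<in> D \<Longrightarrow> east u \<in> D \<Longrightarrow> p u \<le> p (east u)"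
  by (simp add: is_rpp_iff)

lemma rpp_south: "is_rpp lam p \<Longrightarrow> u \<in> D \<Longrightarrow> south u \<in> D \<Longrightarrow> p u \<le> p (south u)"
  by (simp add: is_rpp_iff)

lemma rpp_column:
  assumes "is_rpp lam p" "(i', j) \<in> D" "1 \<le> i" "i \<le> i'"
  shows "p (i, j) \<le> p (i', j)"
  using assms(4,2)
proof (induction i' rule: int_ge_induct)
  case (step i')
  then have "(i', j) \<in> D"
    using diagram_closed[of "i' + 1" j i' j] assms(3) diagram_pos[OF step.prems] by simp
  then show ?case using step rpp_south[OF assms(1), of "(i', j)"] by (simp add: south_def)
qed simp

lemma rpp_west: "is_rpp lam p \<Longrightarrow> u \<in> D \<Longrightarrow> p (west u) \<le> p u"
  using rpp_east[of p "west u"] rpp_off[of p "west u"]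
  by (cases "west u \<in> D") (auto simp: west_def east_def)

text \<open>\<open>region_B\<close> and \<open>region_I\<close> differ only in the step after the
  cell, so their union just asks for a vertical step before it. Below the diagram the entry is
  infinite and the equality test fails.\<close>

lemma ins_step_eq:
  "u \<in> D \<Longrightarrow> ins_step lam p u =
     (if \<not> horiz (content u - 1) \<and> south u \<in> D \<and> p u = p (south u) then south u else west u)"
  by (auto simp: ins_step_def regions entry_diagram entry_south)

abbreviation walk :: "(cell \<Rightarrow> nat) \<Rightarrow> cell \<Rightarrow> nat \<Rightarrow> cell" where
  "walk p t k \<equiv> (ins_step lam p ^^ k) t"

lemma content_ins_step: "content (ins_step lam p u) = content u - 1"
  by (simp add: ins_step_def content_def south_def west_def)

lemma content_walk: "content (walk p t k) = content t - int k"
  by (induction k) (simp_all add: content_ins_step)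

lemma ins_walk_eq: "ins_walk lam p n t = map (walk p t) [0..<Suc n]"
proof (induction n arbitrary: t)
  case (Suc n)
  have "[0..<Suc (Suc n)] = 0 # map Suc [0..<Suc n]"
    by (simp add: map_Suc_upt upt_conv_Cons del: upt_Suc)
  then show ?case using Suc by (simp add: funpow_swap1 del: upt_Suc)
qed simp

lemma set_ins_walk: "set (ins_walk lam p n t) = walk p t ` {..n}"
  by (auto simp: ins_walk_eq atLeast0LessThan lessThan_Suc_atMost simp del: upt_Suc)

lemma last_ins_walk: "last (ins_walk lam p n t) = walk p t n"
  by (simp add: ins_walk_eq)

lemma hd_ins_walk: "hd (ins_walk lam p n t) = t"
  by (cases n) auto

text \<open>No cell strictly before \<open>m\<close> in the content order is a candidate, in a form that does not
  single out \<open>\<O>\<close> or mention the northern neighbour.\<close>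

definition flat_before :: "(cell \<Rightarrow> nat) \<Rightarrow> cell \<Rightarrow> bool" where
  "flat_before p m \<longleftrightarrow>
     (\<forall>v\<in>D. horiz (content v - 1) \<and> \<not> content_le m v \<longrightarrow> p v = p (west v))"

text \<open>Both kinds of candidates have a horizontal step before them and a strict increase from
  the west, which flatness excludes before \<open>m\<close>.\<close>

lemma flat_before_content_min:
  assumes "flat_before p m" "m \<in> cand lam p" "\<And>v. v \<notin> D \<Longrightarrow> p v = 0"
  shows "is_content_min (cand lam p) m"
  unfolding is_content_min_def
proof (intro conjI ballI)
  fix v assume v: "v \<in> cand lam p"
  then have D: "v \<in> D" by (auto simp: cand_def region_O_def region_A_def)
  then have "p (west v) < p v" "horiz (content v - 1)"
    using v assms(3) by (auto simp: cand_def regions entry_diagram entry_west)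
  then show "content_le m v" using assms(1) D by (auto simp: flat_before_def)
qed fact

end

section \<open>Inserting one rim-hook\<close>

text \<open>Here \<open>t\<close> is the tail and \<open>n\<close> the length of the hook, so
  \<open>content t - int n\<close> is the head diagonal. Flatness stops short of that diagonal,
  where an earlier insertion with the same head content may have left a candidate.\<close>

locale insertion_walk = young +
  fixes p :: "cell \<Rightarrow> nat" and t :: cell and n :: nat
  assumes rpp: "is_rpp lam p"
    and tail: "t \<in> D" "east t \<notin> D"
    and head: "\<exists>x\<in>D. content x = content t - int n \<and> south x \<notin> D"
    and flat: "\<And>v. v \<in> D \<Longrightarrow> content t - int n < content v \<Longrightarrow> horiz (content v - 1)
                 \<Longrightarrow> p v = p (west v)"
begin

abbreviation w :: "nat \<Rightarrow> cell" where "w \<equiv> walk p t"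

definition diag_strict :: "cell \<Rightarrow> bool" where
  "diag_strict u \<longleftrightarrow> (east (south u) \<in> D \<longrightarrow> p u < p (east (south u)))"

lemma horiz_head: "horiz (content t - int n - 1)"
  using head no_south_imp_horiz by metis

text \<open>After a horizontal boundary step, flatness carries the diagonal inequality over to
  \<open>south u\<close>. After a vertical one, the walk goes west only if the entries of
  \<open>u\<close> and \<open>south u\<close> differ.\<close>

lemma west_move_strict:
  assumes "u \<in> D" "diag_strict u" "content t - int n < content u"
    and "ins_step lam p u = west u" "south u \<in> D"
  shows "p u < p (south u)"
proof (cases "horiz (content u - 1)")
  case True
  then have "east (south u) \<in> D" using assms horiz_imp_southeast by blast
  moreover have "content (east (south u)) = content u" "west (east (south u)) = south u"
    by (simp_all add: content_def east_def south_def west_def)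
  ultimately show ?thesis
    using flat[of "east (south u)"] True assms by (simp add: diag_strict_def)
next
  case False
  have "south u \<noteq> west u" by (simp add: south_def west_def)
  then have "p u \<noteq> p (south u)" using False assms by (auto simp: ins_step_eq)
  then show ?thesis using rpp_south[OF rpp, of u] assms by linarith
qed

text \<open>The south-east neighbour of \<open>west u\<close> is \<open>south u\<close>, so a west
  move is covered by \<open>west_move_strict\<close>. A south move keeps the entry, while the entry
  diagonally opposite can only grow.\<close>

lemma diag_strict_step:
  assumes "u \<in> D" "diag_strict u" "content t - int n < content u" "ins_step lam p u \<in> D"
  shows "diag_strict (ins_step lam p u)"
proof (cases "ins_step lam p u = west u")
  case True
  have "east (south (west u)) = south u" by (simp add: east_def south_def west_def)
  then show ?thesis
    using west_move_strict[OF assms(1-3) True] rpp_west[OF rpp assms(1)] True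
    by (auto simp: diag_strict_def)
next
  case False
  then have u: "ins_step lam p u = south u" "p u = p (south u)" "south u \<in> D"
    using assms(1) by (auto simp: ins_step_eq split: if_splits)
  have eq: "east (south (south u)) = south (east (south u))"
    by (simp add: east_def south_def)
  show ?thesis unfolding diag_strict_def u(1) eq
  proof
    assume *: "south (east (south u)) \<in> D"
    then have "east (south u) \<in> D"
      using diagram_closed[of "fst u + 2" "snd u + 1" "fst u + 1" "snd u + 1"]
        diagram_pos[OF assms(1)] by (auto simp: east_def south_def add.commute)
    then show "p (south u) < p (south (east (south u)))"
      using assms(2) u(2) rpp_south[OF rpp _ *] by (simp add: diag_strict_def)
  qed
qed

lemma diag_strict_tail: "diag_strict t"
  using no_east_imp_not_horiz tail by (simp add: diag_strict_def)

text \<open>The walk can leave the diagram only by a west move in the first column, and there the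
  strict increase to the south contradicts a zero further down.\<close>

lemma w_inside_if_flat:
  assumes "\<And>v. v \<in> D \<Longrightarrow> content v = content t - int n \<Longrightarrow> p v = p (west v)" "k \<le> n"
  shows "w k \<in> D \<and> diag_strict (w k)"
  using assms(2)
proof (induction k)
  case 0
  then show ?case using tail diag_strict_tail by simp
next
  case (Suc k)
  let ?u = "w k" and ?a = "content t - int n"
  have u: "?u \<in> D" "diag_strict ?u" and gt: "?a < content ?u"
    using Suc by (simp_all add: content_walk)
  have "ins_step lam p ?u \<in> D"
  proof (rule ccontr)
    assume out: "ins_step lam p ?u \<notin> D"
    then have west: "ins_step lam p ?u = west ?u"
      using u by (auto simp: ins_step_eq split: if_splits)
    then have snd: "snd ?u = 1" using out west_diagram u by metis
    obtain x where x: "x \<in> D" "content x = ?a" using head by blast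
    \<comment> \<open>\<open>(1 - ?a, 1)\<close> is the first-column cell of the head diagonal. It
      is weakly north-west of \<open>x\<close>, hence in the diagram, and below \<open>?u\<close>,
      whose content is larger.\<close>
    have "1 - ?a \<le> fst x" "fst ?u < 1 - ?a"
      using x diagram_pos[OF x(1)] gt snd by (auto simp: content_def)
    then have bottom: "(1 - ?a, 1) \<in> D" "(fst ?u + 1, 1) \<in> D"
      using diagram_closed[of "fst x" "snd x" _ 1] diagram_pos[OF x(1)] diagram_pos[OF u(1)] x
      by auto
    have "p ?u < p (south ?u)"
      using west_move_strict[OF u gt west] bottom snd by (simp add: south_def)
    also have "\<dots> \<le> p (1 - ?a, 1)"
      using rpp_column[OF rpp bottom(1), of "fst ?u + 1"] snd \<open>fst ?u < 1 - ?a\<close>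
        diagram_pos[OF u(1)] by (simp add: south_def)
    also have "\<dots> = 0"
      using assms(1)[OF bottom(1)] rpp_off[OF rpp, of "west (1 - ?a, 1)"]
      by (auto simp: content_def west_def diagram_def)
    finally show False by simp
  qed
  then show ?case using diag_strict_step[OF u gt] by simp
qed

end

text \<open>\<open>flat_head\<close> extends flatness to those cells of the head diagonal that lie
  south-east of the actual head \<open>w n\<close>.\<close>

locale insertion_inside = insertion_walk +
  assumes inside: "\<And>k. k \<le> n \<Longrightarrow> w k \<in> D"
    and flat_head: "flat_before p (w n)"
begin

abbreviation P :: "cell list" where "P \<equiv> ins_walk lam p n t"
abbreviation q :: "cell \<Rightarrow> nat" where "q \<equiv> add_path p P"

lemma set_P: "set P = w ` {..n}"
  by (rule set_ins_walk)

lemma diag_strict_w: "k \<le> n \<Longrightarrow> diag_strict (w k)"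
proof (induction k)
  case 0
  then show ?case using diag_strict_tail by simp
next
  case (Suc k)
  then show ?case
    using diag_strict_step[of "w k"] inside[of k] inside[of "Suc k"] by (simp add: content_walk)
qed

lemma P_content: "u \<in> set P \<Longrightarrow> content t - int n \<le> content u"
  by (auto simp: set_P content_walk)

lemma P_diagram: "u \<in> set P \<Longrightarrow> u \<in> D"
  using inside by (auto simp: set_P)

lemma P_eq:
  assumes "u \<in> set P" "v \<in> set P" "content u = content v"
  shows "u = v"
  using assms by (auto simp: set_P content_walk)

lemma P_step: "u \<in> set P \<Longrightarrow> content t - int n < content u \<Longrightarrow> ins_step lam p u \<in> set P"
proof -
  assume "u \<in> set P" "content t - int n < content u"
  then obtain k where "u = w k" "k < n" by (auto simp: set_P content_walk)
  then have "ins_step lam p u = w (Suc k)" "Suc k \<le> n" by simp_all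
  then show ?thesis unfolding set_P by blast
qed

lemma P_pred:
  assumes "u \<in> set P" "u \<noteq> t"
  obtains v where "v \<in> set P" "u = ins_step lam p v" "content v = content u + 1"
proof -
  obtain k where k: "u = w k" "k \<le> n" using assms(1) by (auto simp: set_P)
  then obtain j where "k = Suc j" using assms(2) by (cases k) auto
  then show thesis using k by (intro that[of "w j"]) (auto simp: set_P content_walk content_ins_step)
qed

lemma P_south_strict:
  assumes "u \<in> set P" "south u \<in> D" "south u \<notin> set P"
  shows "p u < p (south u)"
proof (cases "content t - int n < content u")
  case True
  then have "ins_step lam p u \<noteq> south u" using P_step assms by metis
  then have "ins_step lam p u = west u" by (auto simp: ins_step_def split: if_splits)
  moreover have "diag_strict u" using assms diag_strict_w by (auto simp: set_P)
  ultimately show ?thesis using west_move_strict True assms P_diagram by blast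
next
  case False
  \<comment> \<open>At the head there is no further step to exploit, so flatness is applied to its
    south-east neighbour, which comes before the head in the content order.\<close>
  then have content: "content u = content t - int n" using P_content[OF assms(1)] by linarith
  then have u: "u = w n" using P_eq[OF assms(1), of "w n"] by (auto simp: set_P content_walk)
  have D: "u \<in> D" using P_diagram assms by blast
  then have "east (south u) \<in> D"
    using horiz_imp_southeast horiz_head assms content by simp
  moreover have "west (east (south u)) = south u" "content (east (south u)) = content u"
    by (simp_all add: east_def south_def west_def content_def)
  moreover have "\<not> content_le u (east (south u))"
    by (simp add: content_le_def east_def south_def content_def)
  ultimately show ?thesis
    using flat_head diag_strict_w[of n] horiz_head content u
    by (simp add: flat_before_def diag_strict_def)
qed

text \<open>A cell whose east neighbour is off the path was entered from the north, and that east
  neighbour is diagonally opposite the predecessor.\<close>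

lemma P_east_strict:
  assumes "u \<in> set P" "east u \<in> D" "east u \<notin> set P"
  shows "p u < p (east u)"
proof -
  have "u \<noteq> t" using assms tail by blast
  then obtain v where v: "v \<in> set P" "u = ins_step lam p v" using P_pred assms by metis
  have "u \<noteq> west v" using v assms by (auto simp: east_def west_def)
  then have "u = south v" "p v = p u"
    using v P_diagram[of v] by (auto simp: ins_step_eq split: if_splits)
  moreover have "diag_strict v" using v diag_strict_w by (auto simp: set_P)
  ultimately show ?thesis using assms by (simp add: diag_strict_def)
qed

text \<open>An inequality is endangered only where the path contains a cell but not its east or
  south neighbour, and there it was strict before.\<close>

lemma rpp_q: "is_rpp lam q"
  unfolding is_rpp_iff
proof (intro conjI allI impI ballI)
  fix u assume "u \<notin> D"
  then show "q u = 0" using P_diagram[of u] rpp_off[OF rpp, of u] by (auto simp: add_path_def)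
next
  fix u assume "u \<in> D" "east u \<in> D"
  then show "q u \<le> q (east u)"
    using P_east_strict[of u] rpp_east[OF rpp, of u] by (auto simp: add_path_def)
next
  fix u assume "u \<in> D" "south u \<in> D"
  then show "q u \<le> q (south u)"
    using P_south_strict[of u] rpp_south[OF rpp, of u] by (auto simp: add_path_def)
qed

lemma sw_path_P: "sw_path lam P"
  unfolding sw_path_def
proof (intro conjI allI impI)
  show "P \<noteq> []" by (simp add: ins_walk_eq)
  show "set P \<subseteq> D" using P_diagram by blast
  fix k assume "Suc k < length P"
  then have "P ! k = w k" "P ! Suc k = w (Suc k)"
    by (simp_all add: ins_walk_eq del: upt_Suc funpow.simps)
  then show "P ! Suc k = south (P ! k) \<or> P ! Suc k = west (P ! k)"
    by (simp add: ins_step_def)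
qed

lemma P_west_step:
  assumes "v \<in> set P" "content t - int n < content v" "horiz (content v - 1)"
  shows "west v \<in> set P"
  using P_step[OF assms(1,2)] assms(3) P_diagram[OF assms(1)] by (simp add: ins_step_eq)

text \<open>The predecessor of \<open>west v\<close> lies on the diagonal of \<open>v\<close>, where
  only west moves are possible, so it is \<open>v\<close>.\<close>

lemma P_west_pred:
  assumes "v \<in> D" "west v \<in> set P" "horiz (content v - 1)"
  shows "v \<in> set P"
proof -
  have "east (west v) = v" by (simp add: east_def west_def)
  then have "west v \<noteq> t" using assms tail by metis
  then obtain u where u: "u \<in> set P" "west v = ins_step lam p u" "content u = content (west v) + 1"
    using P_pred assms by metis
  moreover have "content (west v) = content v - 1" by (simp add: content_def west_def)
  ultimately have "content u = content v" by simp
  then have "west v = west u" using u(2) P_diagram[OF u(1)] assms(3) by (simp add: ins_step_eq)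
  then have "v = u" by (simp add: west_def prod_eq_iff)
  then show ?thesis using u(1) by simp
qed

text \<open>After a horizontal step the path contains \<open>v\<close> exactly when it contains
  \<open>west v\<close>, so equal entries are raised together. The head itself would be an
  exception, but it is not before itself.\<close>

lemma flat_q: "flat_before q (w n)"
  unfolding flat_before_def
proof (intro ballI impI)
  fix v assume v: "v \<in> D" "horiz (content v - 1) \<and> \<not> content_le (w n) v"
  then have eq: "p v = p (west v)" using flat_head by (simp add: flat_before_def)
  have "v \<in> set P \<longleftrightarrow> west v \<in> set P"
  proof
    assume P: "v \<in> set P"
    have "content t - int n < content v"
    proof (rule ccontr)
      assume "\<not> ?thesis"
      then have "v = w n"
        using P P_content[OF P] by (intro P_eq) (auto simp: set_P content_walk)
      then show False using v by (simp add: content_le_def)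
    qed
    then show "west v \<in> set P" using P_west_step P v by blast
  qed (use P_west_pred v in blast)
  then show "q v = q (west v)" using eq by (simp add: add_path_def)
qed

lemma head_cand: "w n \<in> cand lam q"
proof -
  let ?u = "w n"
  have u: "?u \<in> D" "?u \<in> set P" "content ?u = content t - int n"
    using inside[of n] by (auto simp: set_P content_walk)
  have off: "\<And>v. v \<notin> D \<Longrightarrow> q v = 0" using rpp_q rpp_off by blast
  have "west ?u \<notin> set P"
    using P_content[of "west ?u"] u by (auto simp: content_def west_def)
  then have west: "entry lam q (west ?u) < entry lam q ?u"
    using rpp_west[OF rpp u(1)] u off by (simp add: entry_west entry_diagram add_path_def)
  show ?thesis
  proof (cases "horiz (content ?u)")
    case False
    then have "?u \<in> region_O lam" using u horiz_head by (simp add: regions)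
    then show ?thesis using west by (simp add: cand_def)
  next
    case True
    then have "?u \<in> region_A lam" using u horiz_head by (simp add: regions)
    \<comment> \<open>A path through the north neighbour would have to move west there, reaching a
      second cell on the head diagonal.\<close>
    moreover have "north ?u \<notin> set P"
    proof
      assume N: "north ?u \<in> set P"
      have c: "content (north ?u) - 1 = content ?u" by (simp add: content_def north_def)
      then have "west (north ?u) \<in> set P" using P_west_step[OF N] True u by simp
      moreover have "content (west (north ?u)) = content ?u" "west (north ?u) \<noteq> ?u"
        by (simp_all add: content_def north_def west_def prod_eq_iff)
      ultimately show False using P_eq u by blast
    qed
    moreover have "p (north ?u) \<le> p ?u"
      using rpp_south[OF rpp, of "north ?u"] rpp_off[OF rpp, of "north ?u"] u
      by (cases "north ?u \<in> D") (auto simp: north_def south_def)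
    ultimately show ?thesis using west u off
      by (simp add: cand_def entry_north entry_diagram add_path_def)
  qed
qed

text \<open>A cell followed by a horizontal boundary step was entered by a west move, and flatness
  equates the two entries. South moves are made only between equal entries.\<close>

lemma compatible_P: "compatible lam P p"
  unfolding compatible_def
proof (intro conjI ballI allI impI)
  fix u assume "u \<in> set P \<inter> (region_I lam \<union> region_A lam)"
  then have u: "u \<in> set P" "u \<in> D" "horiz (content u)"
    using P_diagram regions by blast+
  then have "u \<noteq> t" using no_east_imp_not_horiz tail by blast
  then obtain v where v: "v \<in> set P" "u = ins_step lam p v" "content v = content u + 1"
    using P_pred u by metis
  then have west: "u = west v" using u P_diagram[OF v(1)] by (simp add: ins_step_eq)
  then have "east u = v" by (simp add: east_def west_def)
  moreover have "p v = p (west v)"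
    using flat[of v] v u P_diagram[OF v(1)] P_content[OF u(1)] by simp
  ultimately show "east u \<in> set P" "entry lam p u = entry lam p (east u)"
    using v west u P_diagram[OF v(1)] by (simp_all add: entry_diagram)
next
  fix u assume u: "u \<in> set P \<and> south u \<in> set P"
  have c: "content (south u) = content u - 1" by (simp add: content_def south_def)
  then have "ins_step lam p u \<in> set P"
    using u P_content[of "south u"] by (intro P_step) auto
  then have "ins_step lam p u = south u"
    using u c by (intro P_eq) (auto simp: content_ins_step)
  moreover have "west u \<noteq> south u" by (simp add: south_def west_def)
  ultimately show "entry lam p u = entry lam p (south u)"
    using u P_diagram[of u] P_diagram[of "south u"]
    by (auto simp: ins_step_eq entry_diagram split: if_splits)
qed

end

section \<open>Successive insertions\<close>

context young
begin

text \<open>Where the two paths meet, a southward step of the old path raises both entries involved,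
  so the new path has to go south as well.\<close>

lemma walk_below:
  assumes inside: "\<And>k. k \<le> n' \<Longrightarrow> walk p' t' k \<in> D"
    and p: "p = add_path p' (ins_walk lam p' n' t')"
    and t: "t \<in> D" "east t \<notin> D"
    and len: "content t - int n = content t' - int n'" "content t' = content t + int d"
    and "k \<le> n"
  shows "walk p t k \<in> D \<and> fst (walk p' t' (k + d)) \<le> fst (walk p t k)"
  using \<open>k \<le> n\<close>
proof (induction k)
  case 0
  \<comment> \<open>After \<open>d\<close> steps the old path is on the diagonal of
    \<open>t\<close>, and \<open>t\<close>, being the end of a row, is the lowest cell
    there.\<close>
  have "walk p' t' d \<in> D" using inside len by simp
  moreover have "content (walk p' t' d) = content t" using len by (simp add: content_walk)
  ultimately show ?case
    using rim_cell_greatest[OF t(1)] no_east_imp_not_horiz t by simp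
next
  case (Suc k)
  let ?u = "walk p t k" and ?v = "walk p' t' (k + d)"
  have k: "Suc (k + d) \<le> n'" using Suc.prems len by linarith
  have u: "?u \<in> D" "fst ?v \<le> fst ?u" using Suc by auto
  have v: "?v \<in> D" "ins_step lam p' ?v \<in> D" using inside[of "k + d"] inside[OF k] k by auto
  have content: "content ?u = content ?v" using len by (simp add: content_walk)
  have below: "fst (ins_step lam p' ?v) \<le> fst (ins_step lam p ?u)"
  proof (cases "?u = ?v \<and> ins_step lam p' ?v \<noteq> west ?v")
    case True
    then have south: "ins_step lam p' ?v = south ?v" "\<not> horiz (content ?v - 1)"
      "south ?v \<in> D" "p' ?v = p' (south ?v)"
      using v(1) by (auto simp: ins_step_eq split: if_splits)
    have "?v \<in> walk p' t' ` {..n'}" using k by auto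
    moreover have "walk p' t' (Suc (k + d)) \<in> walk p' t' ` {..n'}" using k by blast
    then have "south ?v \<in> walk p' t' ` {..n'}" using south(1) by simp
    ultimately have "p ?v = p (south ?v)"
      using south(4) by (simp add: p add_path_def set_ins_walk)
    then show ?thesis using True south v(1) by (simp add: ins_step_eq)
  next
    case False
    show ?thesis
    proof (cases "?u = ?v")
      case True
      then show ?thesis using False by (auto simp: ins_step_def west_def south_def)
    next
      case neq: False
      \<comment> \<open>Distinct cells of a diagonal are at least one row apart, and a step descends
        by at most one row.\<close>
      then have "fst ?v < fst ?u" using u content by (auto simp: content_def prod_eq_iff)
      then show ?thesis by (auto simp: ins_step_def west_def south_def)
    qed
  qed
  have "ins_step lam p ?u \<in> D"
  proof (cases "ins_step lam p ?u = west ?u")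
    case True
    \<comment> \<open>On one diagonal lower means further east, so the new cell is no further west
      than the old one, which is in the diagram.\<close>
    have "snd ?u \<noteq> 1"
    proof -
      have "content (ins_step lam p ?u) = content (ins_step lam p' ?v)"
        using content by (simp add: content_ins_step)
      then have "1 \<le> snd (ins_step lam p ?u)"
        using below diagram_pos[OF v(2)] by (simp add: content_def)
      then show ?thesis using True by (simp add: west_def)
    qed
    then show ?thesis using True west_diagram u by simp
  qed (use u in \<open>auto simp: ins_step_eq split: if_splits\<close>)
  then show ?case using below by simp
qed

section \<open>Rim-hooks compared by the contents of their ends\<close>

lemma rim_hook_facts:
  assumes "rim_hook lam h"
  shows "ne_tail h \<in> D" "east (ne_tail h) \<notin> D" "ne_head h \<in> D" "south (ne_head h) \<notin> D"
    and "content (ne_head h) = content (ne_tail h) - int (path_len h)"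
proof -
  have ne: "h \<noteq> []" "set h \<subseteq> D"
    and step: "\<And>k. Suc k < length h \<Longrightarrow> h ! Suc k = north (h ! k) \<or> h ! Suc k = east (h ! k)"
    using assms by (auto simp: rim_hook_def ne_path_def)
  show "ne_tail h \<in> D" "ne_head h \<in> D" using ne by (auto simp: ne_tail_def ne_head_def)
  show "east (ne_tail h) \<notin> D" "south (ne_head h) \<notin> D" using assms by (simp_all add: rim_hook_def)
  have "content (h ! k) = content (h ! 0) + int k" if "k < length h" for k
    using that
  proof (induction k)
    case (Suc k)
    then show ?case using step[of k] by (auto simp: content_def north_def east_def)
  qed simp
  from this[of "length h - 1"]
  show "content (ne_head h) = content (ne_tail h) - int (path_len h)"
    using ne by (simp add: ne_head_def ne_tail_def path_len_def hd_conv_nth last_conv_nth)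
qed

text \<open>A column further east ends no lower, so its head has larger content. In equal columns
  the heads coincide, and the lower tail row is no longer.\<close>

lemma rim_hook_le_cases:
  assumes "rim_hook_le lam h h'"
  shows "content (ne_head h') < content (ne_head h) \<or>
    content (ne_head h') = content (ne_head h) \<and> content (ne_tail h) \<le> content (ne_tail h')"
proof -
  obtain u v where uv: "rim_hook_of lam u h" "rim_hook_of lam v h'" "revlex_le u v"
    using assms by (auto simp: rim_hook_le_def)
  then have h: "rim_hook lam h" "rim_hook lam h'" by (auto simp: rim_hook_of_def)
  note facts = rim_hook_facts[OF h(1)] rim_hook_facts[OF h(2)]
  consider "snd v < snd u" | "snd u = snd v" "fst v \<le> fst u"
    using uv by (auto simp: revlex_le_def)
  then show ?thesis
  proof cases
    case 1
    have head: "snd (ne_head h) = snd u" "snd (ne_head h') = snd v"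
      using uv by (auto simp: rim_hook_of_def)
    have "fst (ne_head h) \<le> fst (ne_head h')"
    proof (rule ccontr)
      assume "\<not> ?thesis"
      moreover have "(fst (ne_head h), snd u) \<in> D" using facts(3) head by (metis prod.collapse)
      ultimately have "south (ne_head h') \<in> D"
        using diagram_pos[OF facts(8)] head 1
          diagram_closed[of "fst (ne_head h)" "snd u" "fst (ne_head h') + 1"
            "snd (ne_head h')"] by (auto simp: south_def)
      then show False using facts by simp
    qed
    then show ?thesis using head 1 by (simp add: content_def)
  next
    case 2
    have "ne_head h = ne_head h'" using uv 2 by (simp add: rim_hook_of_def)
    moreover have tail: "fst (ne_tail h) = fst u" "fst (ne_tail h') = fst v"
      using uv by (auto simp: rim_hook_of_def)
    have "snd (ne_tail h) \<le> snd (ne_tail h')"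
    proof (rule ccontr)
      assume "\<not> ?thesis"
      moreover have "(fst u, snd (ne_tail h)) \<in> D" using facts(1) tail by (metis prod.collapse)
      ultimately have "east (ne_tail h') \<in> D"
        using diagram_pos[OF facts(6)] tail 2
          diagram_closed[of "fst u" "snd (ne_tail h)" "fst (ne_tail h')"
            "snd (ne_tail h') + 1"] by (auto simp: east_def)
      then show False using facts by simp
    qed
    ultimately show ?thesis using tail 2 by (simp add: content_def)
  qed
qed

lemma ins_eq: "ins lam h p = add_path p (ins_walk lam p (path_len h) (ne_tail h))"
  by (simp add: ins_def ins_path_def)

lemma insertion_walk_hook:
  assumes "rim_hook lam h" "is_rpp lam p"
    and "\<And>v. v \<in> D \<Longrightarrow> content (ne_head h) < content v \<Longrightarrow> horiz (content v - 1)
           \<Longrightarrow> p v = p (west v)"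
  shows "insertion_walk lam p (ne_tail h) (path_len h)"
proof -
  have "\<exists>x\<in>D. content x = content (ne_tail h) - int (path_len h) \<and> south x \<notin> D"
    using rim_hook_facts[OF assms(1)] by metis
  then show ?thesis
    using assms rim_hook_facts[OF assms(1)] by unfold_locales auto
qed

lemma insertion_inside_hook_flat:
  assumes "rim_hook lam h" "is_rpp lam p"
    and "\<And>v. v \<in> D \<Longrightarrow> content (ne_head h) \<le> content v \<Longrightarrow> horiz (content v - 1)
           \<Longrightarrow> p v = p (west v)"
  shows "insertion_inside lam p (ne_tail h) (path_len h)"
proof -
  interpret insertion_walk lam p "ne_tail h" "path_len h"
    using assms by (intro insertion_walk_hook) auto
  have head: "content (ne_head h) = content (ne_tail h) - int (path_len h)"
    using rim_hook_facts[OF assms(1)] by blast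
  show ?thesis
  proof
    fix k assume "k \<le> path_len h"
    then show "w k \<in> D" using w_inside_if_flat assms(3) head horiz_head by simp
  next
    show "flat_before p (w (path_len h))"
      using assms(3) head by (auto simp: flat_before_def content_le_def content_walk)
  qed
qed

text \<open>The induction step: \<open>flat_q\<close> of the old insertion supplies the flatness
  assumed by the new one, split by whether the head diagonal moves or stays.\<close>

lemma insertion_inside_hook:
  assumes hooks: "rim_hook lam h" "rim_hook lam h'" "rim_hook_le lam h h'"
    and old: "insertion_inside lam p (ne_tail h') (path_len h')"
  shows "insertion_inside lam (ins lam h' p) (ne_tail h) (path_len h)"
proof -
  interpret old: insertion_inside lam p "ne_tail h'" "path_len h'" by fact
  let ?q = "ins lam h' p"
  have q: "is_rpp lam ?q" "flat_before ?q (old.w (path_len h'))"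
    using old.rpp_q old.flat_q by (simp_all add: ins_eq)
  have heads: "content (ne_head h) = content (ne_tail h) - int (path_len h)"
    "content (ne_head h') = content (ne_tail h') - int (path_len h')"
    using rim_hook_facts hooks by blast+
  show ?thesis
  proof (cases "content (ne_head h') < content (ne_head h)")
    case True
    show ?thesis
    proof (rule insertion_inside_hook_flat[OF hooks(1) q(1)])
      fix v assume "v \<in> D" "content (ne_head h) \<le> content v" "horiz (content v - 1)"
      then show "?q v = ?q (west v)"
        using True q(2) heads by (simp add: flat_before_def content_le_def content_walk)
    qed
  next
    case False
    then have same: "content (ne_head h') = content (ne_head h)"
      and le: "content (ne_tail h) \<le> content (ne_tail h')"
      using rim_hook_le_cases[OF hooks(3)] by auto
    interpret insertion_walk lam ?q "ne_tail h" "path_len h"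
    proof (rule insertion_walk_hook[OF hooks(1) q(1)])
      fix v assume "v \<in> D" "content (ne_head h) < content v" "horiz (content v - 1)"
      then show "?q v = ?q (west v)"
        using same q(2) heads by (simp add: flat_before_def content_le_def content_walk)
    qed
    define d where "d = nat (content (ne_tail h') - content (ne_tail h))"
    have d: "content (ne_tail h') = content (ne_tail h) + int d" "path_len h + d = path_len h'"
      using le same heads by (simp_all add: d_def)
    have below: "w k \<in> D \<and> fst (old.w (k + d)) \<le> fst (w k)" if "k \<le> path_len h" for k
      using old.inside d that
      by (intro walk_below[OF _ _ tail, of "path_len h'" p "ne_tail h'" _ "path_len h"])
        (auto simp: ins_eq)
    show ?thesis
    proof
      show "w k \<in> D" if "k \<le> path_len h" for k using below that by blast
      \<comment> \<open>Both heads lie on one diagonal and the new one is weakly lower, so every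
        cell before the new head is before the old one.\<close>
      have "content_le (w (path_len h)) v" if "content_le (old.w (path_len h')) v" for v
        using that below[of "path_len h"] d by (auto simp: content_le_def content_walk)
      then show "flat_before ?q (w (path_len h))"
        using q(2) unfolding flat_before_def by blast
    qed
  qed
qed

text \<open>The zero filling is flat everywhere, which starts the induction at the innermost
  insertion; each later hook relies only on the one inserted just before it.\<close>

lemma insertion_inside_ins_list:
  assumes "\<forall>h\<in>set (h # hs). rim_hook lam h"
    and "\<forall>i. Suc i < length (h # hs) \<longrightarrow> rim_hook_le lam ((h # hs) ! i) ((h # hs) ! Suc i)"
  shows "insertion_inside lam (ins_list lam hs) (ne_tail h) (path_len h)"
  using assms
proof (induction hs arbitrary: h)
  case Nil
  have "is_rpp lam zero_rpp" by (simp add: is_rpp_iff zero_rpp_def)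
  then show ?case
    using Nil by (auto simp: ins_list_def zero_rpp_def intro: insertion_inside_hook_flat)
next
  case (Cons h' hs)
  then have "insertion_inside lam (ins_list lam hs) (ne_tail h') (path_len h')"
    by (intro Cons.IH) auto
  moreover have "rim_hook_le lam h h'" using Cons.prems(2) by force
  ultimately have "insertion_inside lam (ins lam h' (ins_list lam hs)) (ne_tail h) (path_len h)"
    using Cons.prems(1) by (intro insertion_inside_hook) auto
  then show ?case by (simp add: ins_list_def)
qed

lemma insertion_inside_conclusion:
  assumes "rim_hook lam h" "insertion_inside lam p (ne_tail h) (path_len h)"
  shows "inserts lam h p"
    and "is_content_min (cand lam (ins lam h p)) (sw_head (ins_path lam h p))"
proof -
  interpret insertion_inside lam p "ne_tail h" "path_len h" by fact
  have "sw_tail P = ne_tail h" "path_len P = path_len h"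
    by (simp_all add: sw_tail_def hd_ins_walk) (simp add: path_len_def ins_walk_eq)
  then show "inserts lam h p"
    unfolding inserts_def using assms(1) rpp sw_path_P compatible_P rpp_q by blast
  show "is_content_min (cand lam (ins lam h p)) (sw_head (ins_path lam h p))"
    using flat_before_content_min[OF flat_q head_cand] rpp_off[OF rpp_q]
    by (simp add: ins_eq sw_head_def ins_path_def last_ins_walk)
qed

end

theorem mainTheorem14:
  fixes lam :: "nat list" and hs :: "cell list list"
  assumes "is_partition lam"
    and "\<forall>h\<in>set hs. rim_hook lam h"
    and "\<forall>i. Suc i < length hs \<longrightarrow> rim_hook_le lam (hs ! i) (hs ! Suc i)"
  shows "\<forall>i < length hs.
    inserts lam (hs ! i) (ins_list lam (drop (Suc i) hs)) \<and>
    is_content_min (cand lam (ins_list lam (drop i hs)))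
      (sw_head (ins_path lam (hs ! i) (ins_list lam (drop (Suc i) hs))))"
proof (intro allI impI)
  interpret young lam using assms(1) by unfold_locales
  fix i assume i: "i < length hs"
  let ?h = "hs ! i" and ?p = "ins_list lam (drop (Suc i) hs)"
  have split: "drop i hs = ?h # drop (Suc i) hs" using i by (simp add: Cons_nth_drop_Suc)
  have "insertion_inside lam ?p (ne_tail ?h) (path_len ?h)"
  proof (rule insertion_inside_ins_list)
    show "\<forall>h\<in>set (?h # drop (Suc i) hs). rim_hook lam h"
      using assms(2) i by (auto dest: in_set_dropD)
    show "\<forall>j. Suc j < length (?h # drop (Suc i) hs) \<longrightarrow>
      rim_hook_le lam ((?h # drop (Suc i) hs) ! j) ((?h # drop (Suc i) hs) ! Suc j)"
      unfolding split[symmetric] using assms(3) by simp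
  qed
  moreover have "rim_hook lam ?h" using assms(2) i by simp
  moreover have "ins_list lam (drop i hs) = ins lam ?h ?p"
    unfolding split by (simp add: ins_list_def)
  ultimately show "inserts lam ?h ?p \<and>
    is_content_min (cand lam (ins_list lam (drop i hs))) (sw_head (ins_path lam ?h ?p))"
    using insertion_inside_conclusion by simp
qed

end
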